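(* Let $\pi$ be a non-trivial hereditary graph property. If there is a $c$-competitive online algorithm with advice for the problem $\textsc{maxASGu}$, then there is a $c$-competitive online algorithm with advice for $\textsc{Max-}\pi$ (without preemption) that uses the same advice; in particular, on inputs of length $n$ it reads the same number of advice bits.
   Context: A graph property is a collection of graphs; it is non-trivial if infinitely many graphs have it and infinitely many graphs do not. It is hereditary if every induced subgraph of a graph with the property also has the property. Online vertex-arrival model: an input is a graph $G$ with vertices $v_1,\dots,v_n$ presented one at a time; when $v_i$ is presented, all edges $\{v_j,v_i\}$ with $j<i$ are revealed. Neither $G$ nor $n$ is known in advance. In $\textsc{Max-}\pi$ (without preemption), upon arrival of each vertex the algorithm irrevocably decides whether to accept it; if $S$ is the set of accepted vertices, the profit is $|S|$ if the induced subgraph $G[S]$ has property $\pi$, and $-\infty$ otherwise; the goal is to maximize profit. Advice model: the algorithm has access to an infinite binary advice string $\phi$ (chosen with knowledge of the whole input), and its output at step $i$ may depend on $\phi$ and the requests seen so far. For a maximization problem, an algorithm is $c$-competitive with advice complexity $b(n)$ if for every $n$ and every input $I$ of length at most $n$ there exists $\phi$ such that the profit of the algorithm on $I$ with advice $\phi$ is at least $\frac{1}{c}$ times the optimal profit on $I$, and at most the first $b(n)$ bits of $\phi$ are read; $c$ may be a function of $n$. Problem $\textsc{maxASGk}$ (maximum asymmetric string guessing, known history): the input is a sequence $\perp, x_1,\dots,x_n$ with $x_i\in\{0,1\}$; the algorithm outputs $y_1,\dots,y_n\in\{0,1\}$ where $y_i$ may depend on the advice and on $x_1,\dots,x_{i-1}$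 (but not on $x_i,\dots,x_n$). The output is feasible if $x_i\le y_i$ for all $i$; the profit is the number of zeros among $y_1,\dots,y_n$ for feasible outputs and $-\infty$ otherwise. $\textsc{maxASGu}$ is the same problem except that the algorithm never sees the values $x_i$ (each request is a dummy symbol $\perp$), so $y_i$ depends only on the advice and $i$. *)

theory Defs
  imports
    "Graph_Theory.Digraph_Component"
    "Graph_Theory.Digraph_Isomorphism"
    "HOL-Library.Extended_Real"
begin

section \<open>Graph properties\<close>

text \<open>Finite simple graphs are symmetric, loop-free digraphs without parallel arcs (locale
  \<^locale>\<open>graph\<close>). The type is large enough to represent every finite graph up to isomorphism.
  The null graph is a graph, and it is an induced subgraph of every graph.\<close>

type_synonym ugraph = "(nat, nat) pre_digraph"

text \<open>A collection of abstract graphs is an isomorphism-closed set of labelled graphs.\<close>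

definition graph_property :: "ugraph set \<Rightarrow> bool" where
  "graph_property \<pi> \<longleftrightarrow>
     (\<forall>G\<in>\<pi>. graph G) \<and> (\<forall>G\<in>\<pi>. \<forall>H. digraph_iso G H \<longrightarrow> H \<in> \<pi>)"

definition graph_iso_rel :: "(ugraph \<times> ugraph) set" where
  "graph_iso_rel = {(G, H). graph G \<and> graph H \<and> digraph_iso G H}"

text \<open>Graphs are counted up to isomorphism: already the one-vertex graph has infinitely many
  labelled copies.\<close>

definition nontrivial :: "ugraph set \<Rightarrow> bool" where
  "nontrivial \<pi> \<longleftrightarrow>
     infinite (\<pi> // graph_iso_rel) \<and> infinite (({G. graph G} - \<pi>) // graph_iso_rel)"

definition hereditary :: "ugraph set \<Rightarrow> bool" where
  "hereditary \<pi> \<longleftrightarrow> (\<forall>G\<in>\<pi>. \<forall>H. induced_subgraph H G \<longrightarrow> H \<in> \<pi>)"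

section \<open>Online maximization problems and algorithms with advice\<close>

text \<open>On an instance the requests are revealed one at a time, and every request is answered before
  the next one is revealed. The length of an instance is the number of its requests.\<close>

record ('inst, 'req, 'ans) max_problem =
  instances :: "'inst set"
  requests :: "'inst \<Rightarrow> 'req list"
  profit :: "'inst \<Rightarrow> 'ans list \<Rightarrow> ereal"

definition inst_length :: "('inst, 'req, 'ans) max_problem \<Rightarrow> 'inst \<Rightarrow> nat" where
  "inst_length P I = length (requests P I)"

definition opt :: "('inst, 'req, 'ans) max_problem \<Rightarrow> 'inst \<Rightarrow> ereal" where
  "opt P I = (SUP ys \<in> {ys. length ys = inst_length P I}. profit P I ys)"

type_synonym advice = "nat \<Rightarrow> bool"

text \<open>The list argument is the sequence of requests seen so far, including the current one.
  \<open>bits_read A \<phi> rs\<close> is the length of the prefix of \<open>\<phi>\<close> that \<open>A\<close> has read in total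
  after processing \<open>rs\<close>.\<close>

record ('req, 'ans) algorithm =
  answer :: "advice \<Rightarrow> 'req list \<Rightarrow> 'ans"
  bits_read :: "advice \<Rightarrow> 'req list \<Rightarrow> nat"

text \<open>Bits that have not been read influence neither the answer nor the amount of advice read.\<close>

definition online_algorithm :: "('req, 'ans) algorithm \<Rightarrow> bool" where
  "online_algorithm A \<longleftrightarrow>
     (\<forall>\<phi> rs r. bits_read A \<phi> rs \<le> bits_read A \<phi> (rs @ [r])) \<and>
     (\<forall>\<phi> \<psi> rs. (\<forall>k < bits_read A \<phi> rs. \<psi> k = \<phi> k) \<longrightarrow>
        answer A \<psi> rs = answer A \<phi> rs \<and> bits_read A \<psi> rs = bits_read A \<phi> rs)"

definition run :: "('req, 'ans) algorithm \<Rightarrow> advice \<Rightarrow> 'req list \<Rightarrow> 'ans list" where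
  "run A \<phi> rs = map (\<lambda>i. answer A \<phi> (take (Suc i) rs)) [0..<length rs]"

definition good_advice ::
  "('inst, 'req, 'ans) max_problem \<Rightarrow> (nat \<Rightarrow> real) \<Rightarrow> (nat \<Rightarrow> nat) \<Rightarrow>
   ('req, 'ans) algorithm \<Rightarrow> nat \<Rightarrow> 'inst \<Rightarrow> advice \<Rightarrow> bool" where
  "good_advice P c b A n I \<phi> \<longleftrightarrow>
     profit P I (run A \<phi> (requests P I)) \<ge> ereal (1 / c n) * opt P I \<and>
     bits_read A \<phi> (requests P I) \<le> b n"

definition competitive ::
  "('inst, 'req, 'ans) max_problem \<Rightarrow> (nat \<Rightarrow> real) \<Rightarrow> (nat \<Rightarrow> nat) \<Rightarrow>
   ('req, 'ans) algorithm \<Rightarrow> bool" where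
  "competitive P c b A \<longleftrightarrow>
     online_algorithm A \<and>
     (\<forall>n. \<forall>I \<in> instances P. inst_length P I \<le> n \<longrightarrow> (\<exists>\<phi>. good_advice P c b A n I \<phi>))"

section \<open>The two problems\<close>

text \<open>Bits are booleans, with 1 as \<^const>\<open>True\<close>; the order on \<^typ>\<open>bool\<close> is \<open>0 < 1\<close>. There is one
  dummy request for each of the bits \<open>x\<^sub>1, \<dots>, x\<^sub>n\<close> to be guessed.\<close>

definition maxASGu :: "(bool list, unit, bool) max_problem" where
  "maxASGu = \<lparr>
     instances = UNIV,
     requests = (\<lambda>x. replicate (length x) ()),
     profit = (\<lambda>x y. if list_all2 (\<le>) x y then ereal (real (count_list y False)) else - \<infinity>) \<rparr>"

text \<open>An instance is a graph together with an arrival order of its vertices. The request of a vertex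
  consists of the (zero-based) arrival positions of its earlier neighbours, so vertex names are not
  visible to the algorithm. The answer \<^const>\<open>True\<close> accepts the vertex.\<close>

definition accepted :: "nat list \<Rightarrow> bool list \<Rightarrow> nat set" where
  "accepted vs ys = {vs ! i | i. i < length vs \<and> ys ! i}"

definition Max_prop :: "ugraph set \<Rightarrow> (ugraph \<times> nat list, nat set, bool) max_problem" where
  "Max_prop \<pi> = \<lparr>
     instances = {(G, vs). graph G \<and> distinct vs \<and> set vs = verts G},
     requests = (\<lambda>(G, vs). map (\<lambda>i. {j. j < i \<and> vs ! j \<rightarrow>\<^bsub>G\<^esub> vs ! i}) [0..<length vs]),
     profit = (\<lambda>(G, vs) ys.
       if G \<restriction> accepted vs ys \<in> \<pi> then ereal (real (card (accepted vs ys))) else - \<infinity>) \<rparr>"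

end

theory Submission
  imports Defs
begin

text \<open>Fix an optimal set of vertices to accept and let \<open>x\<close> mark the vertices outside it by 1. A
  feasible guess for \<open>x\<close> puts its zeros inside the optimal set, so by heredity accepting exactly the
  zeros is feasible. Hence the online algorithm that negates the guesses turns a solution for
  \<open>x\<close> into one of at least the same profit, and both instances have the same optimum.\<close>

text \<open>An arc with both ends in \<open>T\<close> has both ends in \<open>S\<close>, so inducing
  on \<open>S\<close> and then on \<open>T\<close> yields the same record as inducing on
  \<open>T\<close> at once. This brings \<open>G \<restriction> T\<close> under the notion of
  heredity.\<close>

lemma induce_subgraph_mono:
  assumes "hereditary \<pi>" "G \<restriction> S \<in> \<pi>" "graph G" "T \<subseteq> S"
  shows "G \<restriction> T \<in> \<pi>"
proof -
  interpret graph G by fact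
  have "wf_digraph (G \<restriction> S)" by (rule wellformed_induce_subgraph)
  then have "induced_subgraph ((G \<restriction> S) \<restriction> T) (G \<restriction> S)"
    using assms(4) by (intro wf_digraph.induced_induce) simp_all
  moreover have "(G \<restriction> S) \<restriction> T = G \<restriction> T"
    using assms(4) by (auto simp: induce_subgraph_def)
  ultimately show ?thesis
    using assms(1,2) by (auto simp: hereditary_def)
qed

lemma nontrivial_nonempty: "nontrivial \<pi> \<Longrightarrow> \<pi> \<noteq> {}"
  by (auto simp: nontrivial_def)

text \<open>Null graphs may differ in their junk \<^const>\<open>tail\<close> and \<^const>\<open>head\<close> functions, so closure under
  isomorphism is needed here.\<close>

lemma null_graph_mem:
  assumes "graph_property \<pi>" "hereditary \<pi>" "\<pi> \<noteq> {}"
  shows "G \<restriction> {} \<in> \<pi>"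
proof -
  obtain H where H: "H \<in> \<pi>" using assms(3) by blast
  then interpret H: graph H using assms(1) by (auto simp: graph_property_def)
  have "H \<restriction> {} \<in> \<pi>"
    using assms(2) H H.induced_induce[of "{}"] by (auto simp: hereditary_def)
  moreover have "digraph_iso (H \<restriction> {}) (G \<restriction> {})"
    unfolding digraph_iso_def
    \<comment> \<open>No vertices or arcs remain, so identities serve as the maps; only
      \<open>iso_head\<close> and \<open>iso_tail\<close> matter, and they replace the functions of
      \<open>H\<close> by those of \<open>G\<close>.\<close>
    by (rule exI[of _ "\<lparr>iso_verts = id, iso_arcs = id, iso_head = head G, iso_tail = tail G\<rparr>"])
      (auto simp: pre_digraph.digraph_isomorphism_def app_iso_def induce_subgraph_def
        H.wellformed_induce_subgraph[unfolded induce_subgraph_def, of "{}", simplified])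
  ultimately show ?thesis
    using assms(1) unfolding graph_property_def by blast
qed

lemma card_accepted:
  assumes "distinct vs" "length ys = length vs"
  shows "card (accepted vs ys) = count_list ys True"
proof -
  have "accepted vs ys = (!) vs ` {i. i < length ys \<and> ys ! i}"
    using assms(2) by (auto simp: accepted_def)
  moreover have "inj_on ((!) vs) {i. i < length ys \<and> ys ! i}"
    using assms by (auto simp: inj_on_def nth_eq_iff_index_eq)
  moreover have "(\<lambda>y. y = True) = (\<lambda>y. y)" by simp
  ultimately show ?thesis
    by (simp add: card_image count_list_eq_length_filter length_filter_conv_card)
qed

lemma count_list_map_Not [simp]:
  "count_list (map Not ys) True = count_list ys False"
  "count_list (map Not ys) False = count_list ys True"
  by (induction ys) auto

text \<open>Each zero of \<open>y\<close> sits above a zero of \<open>x\<close>. This bounds the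
  profit of every feasible guess.\<close>

lemma count_list_False_antimono:
  "list_all2 (\<le>) x y \<Longrightarrow> count_list y False \<le> count_list x False"
  by (induction rule: list_all2_induct) auto

lemma accepted_map_Not_mono:
  assumes "list_all2 (\<le>) x y" "length x = length vs"
  shows "accepted vs (map Not y) \<subseteq> accepted vs (map Not x)"
  using assms by (fastforce simp: accepted_def list_all2_conv_all_nth)

text \<open>Boolean answer lists of a fixed length form a finite nonempty set, so the supremum in
  \<open>opt\<close> is a maximum. An optimal vertex set is obtained from this.\<close>

lemma opt_attained: "\<exists>ys. length ys = inst_length P I \<and> profit P I (ys :: bool list) = opt P I"
proof -
  let ?Y = "{ys :: bool list. length ys = inst_length P I}"
  have "finite ?Y"
    using finite_lists_length_eq[of "UNIV :: bool set"] by simp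
  moreover have "?Y \<noteq> {}"
    by (auto intro: exI[of _ "replicate (inst_length P I) True"])
  ultimately have "Max (profit P I ` ?Y) \<in> profit P I ` ?Y"
    and "Max (profit P I ` ?Y) = opt P I"
    unfolding opt_def by (intro Max_in Max_Sup; simp)+
  then show ?thesis by force
qed

lemma opt_ge: "length ys = inst_length P I \<Longrightarrow> profit P I ys \<le> opt P I"
  unfolding opt_def by (rule SUP_upper) simp

lemma inst_length_Max_prop [simp]: "inst_length (Max_prop \<pi>) (G, vs) = length vs"
  by (simp add: inst_length_def Max_prop_def)

lemma inst_length_maxASGu [simp]: "inst_length maxASGu x = length x"
  by (simp add: inst_length_def maxASGu_def)

lemma opt_maxASGu: "opt maxASGu x = ereal (real (count_list x False))"
proof (rule antisym)
  show "opt maxASGu x \<le> ereal (real (count_list x False))"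
    unfolding opt_def
    by (rule SUP_least) (auto simp: maxASGu_def dest: count_list_False_antimono)
  \<comment> \<open>The guess \<open>x\<close> itself is feasible and attains the upper
    bound.\<close>
  have "profit maxASGu x x = ereal (real (count_list x False))"
    by (simp add: maxASGu_def list_all2_refl)
  then show "ereal (real (count_list x False)) \<le> opt maxASGu x"
    using opt_ge[of x maxASGu x] by simp
qed

text \<open>The last inequality ranges over all guesses \<open>y\<close>, so it can later be applied
  to the output of any algorithm under any advice.\<close>

lemma exists_maxASGu_instance:
  assumes "graph_property \<pi>" "nontrivial \<pi>" "hereditary \<pi>"
    and "(G, vs) \<in> instances (Max_prop \<pi>)"
  obtains x where "length x = length vs" "opt maxASGu x = opt (Max_prop \<pi>) (G, vs)"
    "\<And>y. length y = length vs \<Longrightarrow>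
      profit maxASGu x y \<le> profit (Max_prop \<pi>) (G, vs) (map Not y)"
proof -
  have G: "graph G" and vs: "distinct vs"
    using assms(4) by (auto simp: Max_prop_def)
  obtain ys where len: "length ys = length vs"
    and opt: "profit (Max_prop \<pi>) (G, vs) ys = opt (Max_prop \<pi>) (G, vs)"
    using opt_attained[of "Max_prop \<pi>" "(G, vs)"] by auto
  \<comment> \<open>Accepting nothing leaves the null graph and earns 0. Hence the optimum is not
    \<open>- \<infinity>\<close>, and the optimal answers \<open>ys\<close> must be
    feasible.\<close>
  have "accepted vs (replicate (length vs) False) = {}"
    by (auto simp: accepted_def)
  then have "0 \<le> profit (Max_prop \<pi>) (G, vs) (replicate (length vs) False)"
    using null_graph_mem[OF assms(1,3) nontrivial_nonempty[OF assms(2)]]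
    by (simp add: Max_prop_def)
  also have "\<dots> \<le> opt (Max_prop \<pi>) (G, vs)"
    by (rule opt_ge) simp
  finally have mem: "G \<restriction> accepted vs ys \<in> \<pi>"
    using opt by (auto simp: Max_prop_def split: if_splits)
  show thesis
  proof (rule that[of "map Not ys"])
    show "length (map Not ys) = length vs" using len by simp
    \<comment> \<open>The zeros of \<open>map Not ys\<close> are the ones of \<open>ys\<close>, and
      as \<open>vs\<close> is distinct they count the accepted vertices.\<close>
    show "opt maxASGu (map Not ys) = opt (Max_prop \<pi>) (G, vs)"
      using mem opt card_accepted[OF vs len] by (simp add: opt_maxASGu Max_prop_def)
    fix y :: "bool list" assume y: "length y = length vs"
    show "profit maxASGu (map Not ys) y \<le> profit (Max_prop \<pi>) (G, vs) (map Not y)"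
    proof (cases "list_all2 (\<le>) (map Not ys) y")
      case True
      then have "accepted vs (map Not y) \<subseteq> accepted vs ys"
        using accepted_map_Not_mono[of "map Not ys" y vs] len by (simp add: comp_def)
      then have "G \<restriction> accepted vs (map Not y) \<in> \<pi>"
        using induce_subgraph_mono[OF assms(3) mem G] by blast
      then show ?thesis
        using True y card_accepted[OF vs, of "map Not y"]
        by (simp add: maxASGu_def Max_prop_def)
    qed (simp add: maxASGu_def)
  qed
qed

text \<open>\<open>A\<close> is fed dummies only, so the revealed edges are ignored and just the
  number of arrivals enters the simulation.\<close>

definition negated_algorithm :: "(unit, bool) algorithm \<Rightarrow> ('req, bool) algorithm" where
  "negated_algorithm A = \<lparr>
     answer = (\<lambda>\<phi> rs. \<not> answer A \<phi> (replicate (length rs) ())),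
     bits_read = (\<lambda>\<phi> rs. bits_read A \<phi> (replicate (length rs) ())) \<rparr>"

lemma online_negated_algorithm:
  assumes "online_algorithm A"
  shows "online_algorithm (negated_algorithm A)"
  using assms unfolding online_algorithm_def negated_algorithm_def
  \<comment> \<open>The flipped rule moves the newest dummy to the end, where the monotonicity
    condition for \<open>A\<close> expects it.\<close>
  by (auto simp flip: replicate_append_same)

lemma run_negated_algorithm:
  "run (negated_algorithm A) \<phi> rs = map Not (run A \<phi> (replicate (length rs) ()))"
  by (simp add: run_def negated_algorithm_def min_absorb2 Suc_le_eq)

lemma bits_read_negated_algorithm:
  "bits_read (negated_algorithm A) \<phi> rs = bits_read A \<phi> (replicate (length rs) ())"
  by (simp add: negated_algorithm_def)

lemma requests_maxASGu: "requests maxASGu x = replicate (length x) ()"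
  by (simp add: maxASGu_def)

lemma length_requests_Max_prop: "length (requests (Max_prop \<pi>) (G, vs)) = length vs"
  by (simp add: Max_prop_def)

text \<open>As the optima agree, the bound \<open>ereal (1 / c n) * opt\<close> is the same for both
  instances, whatever the value of \<open>c n\<close>; the profit can only grow, and the same prefix
  of \<open>\<phi>\<close> is read.\<close>

lemma good_advice_negated_algorithm:
  assumes "length x = length vs" "opt maxASGu x = opt (Max_prop \<pi>) (G, vs)"
    and "\<And>y. length y = length vs \<Longrightarrow>
      profit maxASGu x y \<le> profit (Max_prop \<pi>) (G, vs) (map Not y)"
    and "good_advice maxASGu c b A n x \<phi>"
  shows "good_advice (Max_prop \<pi>) c b (negated_algorithm A) n (G, vs) \<phi>"
proof -
  let ?y = "run A \<phi> (replicate (length vs) ())"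
  have "length ?y = length vs" by (simp add: run_def)
  from assms(3)[OF this] show ?thesis
    using assms(1,2,4)
    by (auto simp: good_advice_def run_negated_algorithm requests_maxASGu
        length_requests_Max_prop bits_read_negated_algorithm)
qed

theorem theorem7:
  fixes \<pi> :: "ugraph set"
    and c :: "nat \<Rightarrow> real"
    and b :: "nat \<Rightarrow> nat"
    and A :: "(unit, bool) algorithm"
  assumes "graph_property \<pi>" and "nontrivial \<pi>" and "hereditary \<pi>"
    and "competitive maxASGu c b A"
  shows "\<exists>B :: (nat set, bool) algorithm.
    competitive (Max_prop \<pi>) c b B \<and>
    (\<forall>I \<in> instances (Max_prop \<pi>). \<exists>x \<in> instances maxASGu.
       inst_length maxASGu x = inst_length (Max_prop \<pi>) I \<and>
       (\<forall>n \<phi>. good_advice maxASGu c b A n x \<phi> \<longrightarrow> good_advice (Max_prop \<pi>) c b B n I \<phi>)) \<and>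
    (\<forall>I \<in> instances (Max_prop \<pi>). \<forall>x \<in> instances maxASGu.
       inst_length maxASGu x = inst_length (Max_prop \<pi>) I \<longrightarrow>
       (\<forall>\<phi>. bits_read B \<phi> (requests (Max_prop \<pi>) I) = bits_read A \<phi> (requests maxASGu x)))"
proof (intro exI[of _ "negated_algorithm A"] conjI)
  let ?B = "negated_algorithm A :: (nat set, bool) algorithm"
  \<comment> \<open>Here \<open>x\<close> is fixed before \<open>n\<close> and
    \<open>\<phi>\<close>, so one guessing instance serves for every advice string, which is passed
    on unchanged. Competitiveness then follows by taking good advice for \<open>x\<close>.\<close>
  show transfer: "\<forall>I \<in> instances (Max_prop \<pi>). \<exists>x \<in> instances maxASGu.
       inst_length maxASGu x = inst_length (Max_prop \<pi>) I \<and>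
       (\<forall>n \<phi>. good_advice maxASGu c b A n x \<phi> \<longrightarrow> good_advice (Max_prop \<pi>) c b ?B n I \<phi>)"
  proof (clarify)
    fix G vs assume "(G, vs) \<in> instances (Max_prop \<pi>)"
    then obtain x where "length x = length vs"
      "opt maxASGu x = opt (Max_prop \<pi>) (G, vs)"
      "\<And>y. length y = length vs \<Longrightarrow>
        profit maxASGu x y \<le> profit (Max_prop \<pi>) (G, vs) (map Not y)"
      using exists_maxASGu_instance[OF assms(1-3)] by blast
    moreover have "x \<in> instances maxASGu" by (simp add: maxASGu_def)
    ultimately show "\<exists>x \<in> instances maxASGu.
       inst_length maxASGu x = inst_length (Max_prop \<pi>) (G, vs) \<and>
       (\<forall>n \<phi>. good_advice maxASGu c b A n x \<phi> \<longrightarrow>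
          good_advice (Max_prop \<pi>) c b ?B n (G, vs) \<phi>)"
      using good_advice_negated_algorithm by (intro bexI[of _ x]) auto
  qed
  show "competitive (Max_prop \<pi>) c b ?B"
    unfolding competitive_def
  proof (intro conjI allI ballI impI)
    show "online_algorithm ?B"
      using assms(4) online_negated_algorithm by (auto simp: competitive_def)
    fix n I assume "I \<in> instances (Max_prop \<pi>)" "inst_length (Max_prop \<pi>) I \<le> n"
    then obtain x where "x \<in> instances maxASGu" "inst_length maxASGu x \<le> n"
      and x: "good_advice maxASGu c b A n x \<phi> \<Longrightarrow> good_advice (Max_prop \<pi>) c b ?B n I \<phi>" for \<phi>
      using transfer by fastforce
    then obtain \<phi> where "good_advice maxASGu c b A n x \<phi>"
      using assms(4) unfolding competitive_def by blast
    then show "\<exists>\<phi>. good_advice (Max_prop \<pi>) c b ?B n I \<phi>"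
      using x by blast
  qed
  show "\<forall>I \<in> instances (Max_prop \<pi>). \<forall>x \<in> instances maxASGu.
       inst_length maxASGu x = inst_length (Max_prop \<pi>) I \<longrightarrow>
       (\<forall>\<phi>. bits_read ?B \<phi> (requests (Max_prop \<pi>) I) = bits_read A \<phi> (requests maxASGu x))"
    by (auto simp: bits_read_negated_algorithm requests_maxASGu inst_length_def)
qed

end
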